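(* Let $\mathbf V\in\mathbb C^{(N-2N_\Omega-1)\times(N+1)}$ be the matrix with entries $\mathbf V_{n-N_\Omega,\ell+1}=\mathrm e^{-\mathrm i\underline\omega_0 n\ell}$ for $n\in\{N_\Omega+1,\dots,N-N_\Omega-1\}$ and $\ell=0,\dots,N$, where $\underline\omega_0=\frac{2\pi}{N}$, and let $\mathbf s\in\mathbb C^{N-2N_\Omega-1}$ be the vector with entries $\mathbf s_{n-N_\Omega}=\widehat{\underline s}^\lambda_{\boldsymbol\theta}[n]$ for $n\in\{N_\Omega+1,\dots,N-N_\Omega-1\}$. Then the orthogonal matching pursuit (OMP) algorithm described in the context, applied to $\mathbf s$ and $\mathbf V$, recovers the parameters $\{c_\ell,t_\ell\}_{\ell\in\mathbb L_\lambda}$ in $P$ iterations if $\mathbb L_\lambda\subseteq\mathcal S^{(P)}$ and $\max_{m\in\mathcal S^{(P)}}|m|<N-2N_\Omega-1$. Here, recovery in $P$ iterations means that the $P$-th iterate $\mathbf c^{(P)}\in\mathbb C^{N+1}$ (components indexed by $0,\dots,N$) satisfies $\mathbf c^{(P)}_\ell=c_\ell$ for $\ell\in\mathbb L_\lambda$ and $\mathbf c^{(P)}_\ell=0$ for $\ell\in\{0,\dots,N\}\setminus\mathbb L_\lambda$, the locations being read off from the indices as $t_\ell=\ell\mathrm T$.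
   Context: Setting. Let $\lambda>0$ (modulo threshold), $\Omega>0$ (bandwidth), $\mathrm T>0$ (radial sampling rate) with $\mathrm T<\frac{\pi}{\Omega}$, and let $K,K'$ be positive integers; put $N=K+K'$, $\omega_0=\frac{2\pi}{(K+K'+1)\mathrm T}$ and $N_\Omega=\lceil\Omega/\omega_0\rceil$. It is assumed that $K'\ge K\ge N_\Omega+1$. Fix a direction $\boldsymbol\theta\in\mathbb S^1$. Let $p_{\boldsymbol\theta}:\mathbb R\to\mathbb R$ be the (low-pass filtered) Radon projection, a function bandlimited to $[-\Omega,\Omega]$, and write $p_{\boldsymbol\theta}[k]=p_{\boldsymbol\theta}((k-K)\mathrm T)$ for $k=0,\dots,N$. Let $\mathscr M_\lambda(t)=t-2\lambda\lfloor\frac{t+\lambda}{2\lambda}\rfloor$ be the modulo operator, $p^\lambda_{\boldsymbol\theta}=\mathscr M_\lambda(p_{\boldsymbol\theta})$, and let $s^\lambda_{\boldsymbol\theta}[k]=p_{\boldsymbol\theta}[k]-p^\lambda_{\boldsymbol\theta}[k]\in2\lambda\mathbb Z$ be the residual for $k=0,\dots,N$. Let $\underline s^\lambda_{\boldsymbol\theta}[k]=s^\lambda_{\boldsymbol\theta}[k+1]-s^\lambda_{\boldsymbol\theta}[k]$, $k=0,\dots,N-1$, be its forward differences, and let $\widehat{\underline s}^\lambda_{\boldsymbol\theta}[n]=\sum_{k=0}^{N-1}\underline s^\lambda_{\boldsymbol\theta}[k]\,\mathrm e^{-2\pi\mathrm i nk/N}$, $n=0,\dots,N-1$, be their discrete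 Fourier transform. Parameters. One writes $\widehat{\underline s}^\lambda_{\boldsymbol\theta}[n]=\sum_{\ell\in\mathbb L_\lambda}c_\ell\exp\bigl(-\mathrm i\frac{\underline\omega_0 n}{\mathrm T}t_\ell\bigr)$ for $n=0,\dots,N-1$, with $\underline\omega_0=\frac{2\pi}{N}$, $\mathbb L_\lambda\subseteq\{0,\dots,N\}$ and $t_\ell=\ell\mathrm T$; concretely, $\mathbb L_\lambda$ is the set of indices $\ell$ with $\underline s^\lambda_{\boldsymbol\theta}[\ell]\neq0$, and $c_\ell=\underline s^\lambda_{\boldsymbol\theta}[\ell]$ for $\ell\in\mathbb L_\lambda$. OMP algorithm. Input: a signal $\mathbf s$, a matrix $\mathbf V$ with columns indexed by $0,\dots,N$, and $\varepsilon>0$. Initialize $\mathbf c^{(0)}=0$, $\mathcal S^{(0)}=\emptyset$. For $i=1,2,\dots$, while $\|\mathbf V^*(\mathbf s-\mathbf V\mathbf c^{(i-1)})\|_\infty>\varepsilon$, do: (1) $j^{(i)}=\arg\max_{0\le j\le N}\bigl|[\mathbf V^*(\mathbf s-\mathbf V\mathbf c^{(i-1)})]_j\bigr|$; (2) $\mathcal S^{(i)}=\mathcal S^{(i-1)}\cup\{j^{(i)}\}$; (3) $\mathbf c^{(i)}=\arg\min_{\mathbf c\in\mathbb C^{N+1}}\{\|\mathbf s-\mathbf V\mathbf c\|_2 : \operatorname{supp}(\mathbf c)\subseteq\mathcal S^{(i)}\}$. Here $\mathcal S^{(P)}$ and $\mathbf c^{(P)}$ denote the index set and coefficient vector after $P$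 iterations. *)

theory Defs
  imports
    "HOL-Analysis.Analysis"
    "Jordan_Normal_Form.Schur_Decomposition"
begin

(* "$" is to denote the components of Jordan_Normal_Form vectors only. *)
unbundle no vec_syntax

section \<open>Modulo residual of a bandlimited function\<close>

text \<open>
  Bandlimited to the frequency interval from -b to b: the function is the inverse Fourier transform
  of an integrable spectrum living on this interval. As the interval is compact, this includes all
  square-integrable spectra, i.e. the Paley-Wiener space, as well as low-pass filtered versions of
  integrable functions.
\<close>

definition bandlimited :: "real \<Rightarrow> (real \<Rightarrow> real) \<Rightarrow> bool" where
  "bandlimited b f \<longleftrightarrow>
     (\<exists>g :: real \<Rightarrow> complex. set_integrable lborel {-b..b} g \<and>
        (\<forall>t. complex_of_real (f t) =
               1 / (2 * complex_of_real pi) *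
               (LINT w:{-b..b}|lborel. g w * exp (\<i> * complex_of_real (w * t)))))"

definition modulo_op :: "real \<Rightarrow> real \<Rightarrow> real" where
  "modulo_op lam t = t - 2 * lam * of_int \<lfloor>(t + lam) / (2 * lam)\<rfloor>"

definition residual :: "real \<Rightarrow> real \<Rightarrow> nat \<Rightarrow> (real \<Rightarrow> real) \<Rightarrow> nat \<Rightarrow> real" where
  "residual lam T K f k =
     (let t = (real k - real K) * T in f t - modulo_op lam (f t))"

definition forward_diff :: "(nat \<Rightarrow> real) \<Rightarrow> nat \<Rightarrow> real" where
  "forward_diff x k = x (k + 1) - x k"

definition dft :: "nat \<Rightarrow> (nat \<Rightarrow> real) \<Rightarrow> nat \<Rightarrow> complex" where
  "dft N x n =
     (\<Sum>k<N. complex_of_real (x k) * exp (- 2 * complex_of_real pi * \<i> * of_nat n * of_nat k / of_nat N))"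

section \<open>Measurement matrix and signal\<close>

text \<open>
  Rows are numbered from 0, so that row r belongs to the frequency n = r + b + 1, where n ranges
  over b + 1, ..., N - b - 1.
\<close>

definition omp_matrix :: "nat \<Rightarrow> nat \<Rightarrow> complex mat" where
  "omp_matrix N b =
     mat (N - 2 * b - 1) (N + 1)
       (\<lambda>(r, l). exp (- \<i> * complex_of_real (2 * pi / real N) * of_nat (r + b + 1) * of_nat l))"

definition omp_signal :: "nat \<Rightarrow> nat \<Rightarrow> (nat \<Rightarrow> real) \<Rightarrow> complex vec" where
  "omp_signal N b x = vec (N - 2 * b - 1) (\<lambda>r. dft N x (r + b + 1))"

section \<open>Orthogonal matching pursuit\<close>

definition l2_norm :: "complex vec \<Rightarrow> real" where
  "l2_norm v = L2_set (\<lambda>i. cmod (v $ i)) {..<dim_vec v}"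

definition max_norm :: "complex vec \<Rightarrow> real" where
  "max_norm v = Max ((\<lambda>i. cmod (v $ i)) ` {..<dim_vec v})"

definition supp :: "complex vec \<Rightarrow> nat set" where
  "supp v = {i. i < dim_vec v \<and> v $ i \<noteq> 0}"

definition correlation :: "complex mat \<Rightarrow> complex vec \<Rightarrow> complex vec \<Rightarrow> complex vec" where
  "correlation V s c = mat_adjoint V *\<^sub>v (s - V *\<^sub>v c)"

text \<open>
  \<open>omp V s \<epsilon> i S c\<close>: the algorithm can perform i iterations, after which the index set is S and the
  coefficient vector is c. This is a relation because neither the maximiser j nor the
  least-squares minimiser need be unique; every choice is allowed. The stopping criterion is
  tested before each iteration.
\<close>

inductive omp :: "complex mat \<Rightarrow> complex vec \<Rightarrow> real \<Rightarrow> nat \<Rightarrow> nat set \<Rightarrow> complex vec \<Rightarrow> bool"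
  for V :: "complex mat" and s :: "complex vec" and \<epsilon> :: real where
  init: "omp V s \<epsilon> 0 {} (0\<^sub>v (dim_col V))"
| step: "omp V s \<epsilon> (Suc i) (insert j S) c'"
    if "omp V s \<epsilon> i S c"
      and "max_norm (correlation V s c) > \<epsilon>"
      and "is_arg_max (\<lambda>j. cmod (correlation V s c $ j)) (\<lambda>j. j < dim_col V) j"
      and "is_arg_min (\<lambda>d. l2_norm (s - V *\<^sub>v d))
             (\<lambda>d. d \<in> carrier_vec (dim_col V) \<and> supp d \<subseteq> insert j S) c'"

text \<open>
  The vector c of length N + 1 encodes exactly the parameters (x l, l T) for l in L. The last
  conjunct, the read-off of the locations, is a consequence of the others.
\<close>

definition recovers :: "nat \<Rightarrow> real \<Rightarrow> nat set \<Rightarrow> (nat \<Rightarrow> real) \<Rightarrow> complex vec \<Rightarrow> bool" where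
  "recovers N T L x c \<longleftrightarrow>
     c \<in> carrier_vec (N + 1) \<and>
     (\<forall>l\<in>L. c $ l = complex_of_real (x l)) \<and>
     (\<forall>l\<in>{0..N} - L. c $ l = 0) \<and>
     {(c $ l, real l * T) |l. l \<in> supp c} = {(complex_of_real (x l), real l * T) |l. l \<in> L}"

end

theory Submission
  imports Defs
begin

text \<open>
  The coefficient vector of a run is always a least-squares minimiser over the vectors supported on
  the current index set \<open>S\<close>. Since \<open>S\<close> contains \<open>L\<close>, the vector of true coefficients is one of these
  competitors, and it reproduces the signal exactly, because the signal is a window of its discrete
  Fourier transform. The least residual is therefore zero, and the computed vector reproduces the
  signal as well (\<open>omp_exact_if_representable\<close>).

  It remains to see that distinct vectors supported on indices below the number \<open>M\<close> of rows have
  different images (\<open>omp_matrix_kernel_trivial\<close>). Row \<open>r\<close> of the measurement matrix evaluates the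
  polynomial with the given coefficients at the \<open>N\<close>-th root of unity with exponent
  \<open>r + N\<^sub>\<Omega> + 1\<close>. These \<open>M\<close> nodes are distinct, because the exponents stay below \<open>N\<close>, and a
  polynomial of degree less than \<open>M\<close> that vanishes at all of them is zero. The bound on \<open>Max S\<close> is
  exactly this degree bound.
\<close>

lemma l2_norm_nonneg: "l2_norm v \<ge> 0"
  by (simp add: l2_norm_def)

lemma vec_eq_zero_iff: "v = 0\<^sub>v (dim_vec v) \<longleftrightarrow> (\<forall>i<dim_vec v. v $ i = 0)"
  by (subst Matrix.vec_eq_iff) auto

lemma l2_norm_eq_0_iff: "l2_norm v = 0 \<longleftrightarrow> v = 0\<^sub>v (dim_vec v)"
  by (auto simp: l2_norm_def L2_set_eq_0_iff vec_eq_zero_iff)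

lemma supp_empty_iff: "supp v = {} \<longleftrightarrow> v = 0\<^sub>v (dim_vec v)"
  by (auto simp: supp_def vec_eq_zero_iff)

lemma supp_minus_subset:
  assumes "dim_vec u = dim_vec v"
  shows "supp (u - v) \<subseteq> supp u \<union> supp v"
  using assms by (auto simp: supp_def)

lemma omp_index_set_subset: "omp V s \<epsilon> i S c \<Longrightarrow> S \<subseteq> {..<dim_col V}"
  by (induction rule: omp.induct) (auto simp: is_arg_max_def)

text \<open>
  The update step demands this property; the initial state also has it, as the zero vector
  is the only one with empty support.
\<close>

lemma omp_least_squares:
  assumes "omp V s \<epsilon> i S c"
  shows "is_arg_min (\<lambda>d. l2_norm (s - V *\<^sub>v d))
           (\<lambda>d. d \<in> carrier_vec (dim_col V) \<and> supp d \<subseteq> S) c"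
  using assms by cases (auto simp: is_arg_min_def supp_empty_iff)

lemma omp_exact_if_representable:
  assumes run: "omp V s \<epsilon> i S c"
    and x: "x \<in> carrier_vec (dim_col V)" "supp x \<subseteq> S" "V *\<^sub>v x = s"
  shows "V *\<^sub>v c = s"
proof -
  have dim: "dim_vec s = dim_row V"
    using x(3) by auto
  have "\<not> l2_norm (s - V *\<^sub>v x) < l2_norm (s - V *\<^sub>v c)"
    using omp_least_squares[OF run] x(1,2) by (auto simp: is_arg_min_def)
  moreover have "l2_norm (s - V *\<^sub>v x) = 0"
    using x(3) by (simp add: l2_norm_eq_0_iff)
  ultimately have "l2_norm (s - V *\<^sub>v c) = 0"
    using l2_norm_nonneg[of "s - V *\<^sub>v c"] by linarith
  then have zero: "s - V *\<^sub>v c = 0\<^sub>v (dim_row V)"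
    by (simp add: l2_norm_eq_0_iff)
  show ?thesis
  proof (rule eq_vecI)
    fix r
    assume "r < dim_vec s"
    then have "r < dim_row V"
      using dim by simp
    then have "(s - V *\<^sub>v c) $ r = 0"
      using zero by simp
    with \<open>r < dim_row V\<close> show "(V *\<^sub>v c) $ r = s $ r"
      by simp
  qed (simp add: dim)
qed

definition dft_node :: "nat \<Rightarrow> nat \<Rightarrow> complex" where
  "dft_node N n = exp (- (2 * complex_of_real pi * \<i> * of_nat n / of_nat N))"

lemma dft_node_power:
  "dft_node N n ^ k = exp (- 2 * complex_of_real pi * \<i> * of_nat n * of_nat k / of_nat N)"
  unfolding dft_node_def exp_of_nat_mult[symmetric] by (rule arg_cong[of _ _ exp]) simp

lemma inj_on_dft_node: "inj_on (dft_node N) {..<N}"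
proof (rule inj_onI)
  fix m n
  assume mn: "m \<in> {..<N}" "n \<in> {..<N}" and "dft_node N m = dft_node N n"
  then have "exp (2 * complex_of_real pi * \<i> * of_nat m / of_nat N) =
             exp (2 * complex_of_real pi * \<i> * of_nat n / of_nat N)"
    by (simp add: dft_node_def exp_minus)
  moreover have "1 \<le> N"
    using mn by simp
  ultimately have "m mod N = n mod N"
    using complex_root_unity_eq[of N m n] by (simp add: cong_def)
  then show "m = n"
    using mn by simp
qed

lemma omp_matrix_mult_index:
  assumes "d \<in> carrier_vec (N + 1)" and "r < N - 2 * b - 1"
  shows "(omp_matrix N b *\<^sub>v d) $ r = (\<Sum>l\<le>N. d $ l * dft_node N (r + b + 1) ^ l)"
proof -
  have "(omp_matrix N b *\<^sub>v d) $ r =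
        (\<Sum>l<N + 1. exp (- \<i> * complex_of_real (2 * pi / real N) * of_nat (r + b + 1) * of_nat l) * d $ l)"
    using assms by (auto simp: omp_matrix_def scalar_prod_def lessThan_atLeast0 intro!: sum.cong)
  also have "\<dots> = (\<Sum>l<N + 1. d $ l * dft_node N (r + b + 1) ^ l)"
    unfolding dft_node_power by (intro sum.cong) (auto simp: mult_ac)
  finally show ?thesis
    by (simp add: lessThan_Suc_atMost)
qed

text \<open>
  Read as coefficients, \<open>d\<close> is a polynomial of degree less than the number of rows that
  vanishes at as many distinct nodes.
\<close>

lemma omp_matrix_kernel_trivial:
  assumes d: "d \<in> carrier_vec (N + 1)"
    and supp: "supp d \<subseteq> {..<N - 2 * b - 1}"
    and zero: "omp_matrix N b *\<^sub>v d = 0\<^sub>v (N - 2 * b - 1)"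
  shows "d = 0\<^sub>v (N + 1)"
proof (cases "N - 2 * b - 1 = 0")
  case True
  then show ?thesis
    using d supp by (auto simp: supp_empty_iff)
next
  case False
  define M where "M = N - 2 * b - 1"
  define q where "q = (\<Sum>l\<le>N. monom (d $ l) l)"
  define A where "A = (\<lambda>r. dft_node N (r + b + 1)) ` {..<M}"
  have coeff_q: "coeff q l = (if l \<le> N then d $ l else 0)" for l
    by (simp add: q_def coeff_sum)
  have "coeff q l = 0" if "l \<ge> M" for l
  proof -
    have "l \<notin> supp d"
      using that supp by (auto simp: M_def)
    then show ?thesis
      using d by (auto simp: coeff_q supp_def)
  qed
  then have "degree q < M"
    using False by (intro degree_lessI) (auto simp: M_def)
  have "inj_on (\<lambda>r. dft_node N (r + b + 1)) {..<M}"
    by (intro inj_onI) (auto simp: M_def dest!: inj_onD[OF inj_on_dft_node])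
  then have "card A = M"
    by (simp add: A_def card_image)
  have "poly q a = 0" if "a \<in> A" for a
  proof -
    from that obtain r where r: "r < M" "a = dft_node N (r + b + 1)"
      by (auto simp: A_def)
    then have "poly q a = (omp_matrix N b *\<^sub>v d) $ r"
      using omp_matrix_mult_index[OF d, of r b]
      by (simp add: q_def poly_sum poly_monom M_def)
    then show ?thesis
      using r zero by (simp add: M_def)
  qed
  then have "q = 0"
    using \<open>degree q < M\<close> \<open>card A = M\<close> by (intro poly_eqI_degree[of A]) auto
  then have "d $ l = 0" if "l \<le> N" for l
    using coeff_q[of l] that by simp
  then show ?thesis
    using d by (intro eq_vecI) auto
qed

lemma omp_matrix_inj_on_low_support:
  assumes u: "u \<in> carrier_vec (N + 1)" "supp u \<subseteq> {..<N - 2 * b - 1}"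
    and v: "v \<in> carrier_vec (N + 1)" "supp v \<subseteq> {..<N - 2 * b - 1}"
    and eq: "omp_matrix N b *\<^sub>v u = omp_matrix N b *\<^sub>v v"
  shows "u = v"
proof -
  have V: "omp_matrix N b \<in> carrier_mat (N - 2 * b - 1) (N + 1)"
    by (simp add: omp_matrix_def)
  have "omp_matrix N b *\<^sub>v (u - v) = 0\<^sub>v (N - 2 * b - 1)"
    using mult_minus_distrib_mat_vec[OF V u(1) v(1)] eq V v(1) by simp
  moreover have "supp (u - v) \<subseteq> {..<N - 2 * b - 1}"
    using supp_minus_subset[of u v] u v by auto
  ultimately have diff: "u - v = 0\<^sub>v (N + 1)"
    using u(1) v(1) by (intro omp_matrix_kernel_trivial) auto
  show ?thesis
  proof (rule eq_vecI)
    fix l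
    assume "l < dim_vec v"
    then show "u $ l = v $ l"
      using arg_cong[OF diff, of "\<lambda>w. w $ l"] u(1) v(1) by simp
  qed (use u(1) v(1) in simp)
qed

text \<open>
  Column \<open>N\<close> of the matrix duplicates column 0, whereas the transform sums over a single period, the
  indices below \<open>N\<close>. The true coefficient vector therefore has a zero in its last entry.
\<close>

lemma omp_matrix_mult_sequence:
  "omp_matrix N b *\<^sub>v vec (N + 1) (\<lambda>l. if l < N then complex_of_real (x l) else 0) = omp_signal N b x"
  (is "_ *\<^sub>v ?x = _")
proof (rule eq_vecI)
  fix r
  assume "r < dim_vec (omp_signal N b x)"
  then have r: "r < N - 2 * b - 1"
    by (simp add: omp_signal_def)
  have "(omp_matrix N b *\<^sub>v ?x) $ r = (\<Sum>l\<le>N. ?x $ l * dft_node N (r + b + 1) ^ l)"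
    using r by (intro omp_matrix_mult_index) auto
  also have "\<dots> = (\<Sum>l<N. complex_of_real (x l) * dft_node N (r + b + 1) ^ l)"
    by (intro sum.mono_neutral_cong_right) auto
  finally show "(omp_matrix N b *\<^sub>v ?x) $ r = omp_signal N b x $ r"
    using r unfolding dft_node_power by (simp add: omp_signal_def dft_def)
qed (simp add: omp_signal_def omp_matrix_def)

text \<open>
  Locations are read off from the support of the vector. This returns \<open>L\<close> and not a proper subset,
  because \<open>L\<close> has no index at which \<open>x\<close> vanishes.
\<close>

lemma recovers_sequence:
  assumes "L = {l \<in> {0..<N}. x l \<noteq> 0}"
  shows "recovers N T L x (vec (N + 1) (\<lambda>l. if l < N then complex_of_real (x l) else 0))"
    (is "recovers N T L x ?x")
proof -
  have supp: "supp ?x = L"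
    using assms by (auto simp: supp_def split: if_splits)
  have entry: "?x $ l = complex_of_real (x l)" if "l \<in> L" for l
    using that assms by simp
  have "{(?x $ l, real l * T) |l. l \<in> supp ?x} =
      {(complex_of_real (x l), real l * T) |l. l \<in> L}"
    unfolding supp using entry by (intro Collect_cong) metis
  then show ?thesis
    using assms unfolding recovers_def by simp
qed

theorem theorem1:
  fixes lam \<Omega> T \<omega>\<^sub>0 \<epsilon> :: real
    and K K' N N\<^sub>\<Omega> P :: nat
    and \<theta> :: "real ^ 2"
    and p :: "real ^ 2 \<Rightarrow> real \<Rightarrow> real"
    and ds :: "nat \<Rightarrow> real"
    and L S :: "nat set"
    and V :: "complex mat"
    and s c :: "complex vec"
  assumes "lam > 0" and "\<Omega> > 0" and "T > 0" and "T < pi / \<Omega>"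
    and "K > 0" and "K' > 0"
    and "N = K + K'"
    and "\<omega>\<^sub>0 = 2 * pi / (real (K + K' + 1) * T)"
    and "N\<^sub>\<Omega> = nat \<lceil>\<Omega> / \<omega>\<^sub>0\<rceil>"
    and "K' \<ge> K" and "K \<ge> N\<^sub>\<Omega> + 1"
    and "\<theta> \<in> sphere 0 1"
    and "bandlimited \<Omega> (p \<theta>)"
    and "ds = forward_diff (residual lam T K (p \<theta>))"
    and "L = {l \<in> {0..<N}. ds l \<noteq> 0}"
    and "V = omp_matrix N N\<^sub>\<Omega>"
    and "s = omp_signal N N\<^sub>\<Omega> ds"
    and "\<epsilon> > 0"
    and "omp V s \<epsilon> P S c"
    and "L \<subseteq> S"
    and "S \<noteq> {} \<longrightarrow> Max S < N - 2 * N\<^sub>\<Omega> - 1"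
  shows "recovers N T L ds c"
proof -
  let ?x = "vec (N + 1) (\<lambda>l. if l < N then complex_of_real (ds l) else 0)"
  have cols: "dim_col V = N + 1"
    using \<open>V = _\<close> by (simp add: omp_matrix_def)
  have supp_x: "supp ?x \<subseteq> S"
    using \<open>L \<subseteq> S\<close> \<open>L = _\<close> by (auto simp: supp_def split: if_splits)
  have fit: "V *\<^sub>v ?x = s"
    unfolding \<open>V = _\<close> \<open>s = _\<close> by (rule omp_matrix_mult_sequence)
  have exact: "V *\<^sub>v c = s"
    by (rule omp_exact_if_representable[OF \<open>omp V s \<epsilon> P S c\<close> _ supp_x fit])
      (simp add: cols)
  have c: "c \<in> carrier_vec (N + 1)" "supp c \<subseteq> S"
    using omp_least_squares[OF \<open>omp V s \<epsilon> P S c\<close>] by (auto simp: is_arg_min_def cols)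
  have "finite S"
    using omp_index_set_subset[OF \<open>omp V s \<epsilon> P S c\<close>] finite_subset by blast
  then have S: "S \<subseteq> {..<N - 2 * N\<^sub>\<Omega> - 1}"
    using \<open>S \<noteq> {} \<longrightarrow> _\<close> by (auto dest: Max_ge)
  have "c = ?x"
  proof (rule omp_matrix_inj_on_low_support)
    show "omp_matrix N N\<^sub>\<Omega> *\<^sub>v c = omp_matrix N N\<^sub>\<Omega> *\<^sub>v ?x"
      using exact fit \<open>V = _\<close> by simp
  qed (use c supp_x S in auto)
  then show ?thesis
    using recovers_sequence[OF \<open>L = _\<close>] by simp
qed

end
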